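(* Let $E$ and $\mathcal{X}$ be Polish spaces with $\mathcal{X}$ compact. Let $h:\mathcal{X}\times E\to\mathbb{R}$ be jointly continuous and bounded from below, and suppose its sub-level sets are compact. Let $V(\nu)=\inf_{x\in\mathcal{X}}\int_E h(x,w)\,\nu(dw)$ for $\nu\in\mathcal{P}(E)$. Let $q\in(1,\infty)$ and $\mu\in\mathcal{P}(E)$ be such that, if $$\psi(w):=\Big(\sup_{x\in\mathcal{X}}h(x,w)\Big)^+,$$ then $\int_E\psi^q\,d\mu<\infty$. Then, for each $\epsilon>0$, $$\limsup_{n\to\infty}\,n^{q-1}\mu^n\big(|V(L_n)-V(\mu)|\ge\epsilon\big)<\infty.$$
   Context: $\mathcal{P}(E)$ is the set of Borel probability measures on $E$; $\mu^n$ is the $n$-fold product measure on $E^n$; $L_n:E^n\to\mathcal{P}(E)$ is $L_n(x_1,\dots,x_n)=\frac1n\sum_{i=1}^n\delta_{x_i}$; $a^+=\max(a,0)$. The sub-level sets of $h$ are the sets $\{(x,w)\in\mathcal{X}\times E:h(x,w)\le c\}$, $c\in\mathbb{R}$. *)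

theory Defs
  imports "HOL-Probability.Probability"
begin

text \<open>
  The Lebesgue integral as the difference of the integrals of the positive and the negative part.
  For \<open>f\<close> bounded from below and \<open>M\<close> finite the subtrahend is finite, so the value is in
  \<open>(-\<infinity>, \<infinity>]\<close>; the Bochner integral would return 0 where this is \<open>\<infinity>\<close>.
\<close>

definition ext_integral :: "'a measure \<Rightarrow> ('a \<Rightarrow> real) \<Rightarrow> ereal" where
  "ext_integral M f =
     enn2ereal (\<integral>\<^sup>+ w. ennreal (f w) \<partial>M) - enn2ereal (\<integral>\<^sup>+ w. ennreal (- f w) \<partial>M)"

definition inf_val :: "('x \<times> 'e \<Rightarrow> real) \<Rightarrow> 'e measure \<Rightarrow> ereal" where
  "inf_val h \<nu> = (INF x. ext_integral \<nu> (\<lambda>w. h (x, w)))"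

text \<open>
  The supremum is a real one; it is genuine when the type \<open>'x\<close> is compact and \<open>h\<close> is
  continuous, since then the values are bounded above.
\<close>

definition sup_pos :: "('x \<times> 'e \<Rightarrow> real) \<Rightarrow> 'e \<Rightarrow> real" where
  "sup_pos h w = max (SUP x. h (x, w)) 0"

text \<open>
  \<open>(1/n) \<Sum>\<^sub>i \<delta>\<^bsub>x\<^sub>i\<^esub>\<close> as a Borel measure, the points being indexed by \<open>i < n\<close>.
  There is no addition of measures in the library, hence the set function is spelled out.
  It is a probability measure for \<open>n > 0\<close> only.
\<close>

definition emp_measure :: "nat \<Rightarrow> (nat \<Rightarrow> 'e::topological_space) \<Rightarrow> 'e measure" where
  "emp_measure n x =
     measure_of UNIV (sets borel) (\<lambda>A. (\<Sum>i<n. emeasure (return borel (x i)) A) / of_nat n)"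

lemma space_emp_measure [simp]: "space (emp_measure n x) = UNIV"
  by (simp add: emp_measure_def space_measure_of_conv)

lemma sets_emp_measure [simp]: "sets (emp_measure n x) = sets borel"
  unfolding emp_measure_def using sets.sigma_sets_eq[of borel] by (simp add: space_borel)

lemma emeasure_emp_measure:
  assumes A: "A \<in> sets borel"
  shows "emeasure (emp_measure n x) A = (\<Sum>i<n. indicator A (x i)) / of_nat n"
proof -
  let ?m = "\<lambda>A. (\<Sum>i<n. emeasure (return borel (x i)) A) / of_nat n"
  have "countably_additive (sets borel) ?m"
  proof (rule countably_additiveI)
    fix B :: "nat \<Rightarrow> 'a set"
    assume B: "range B \<subseteq> sets borel" "disjoint_family B"
    have "(\<Sum>j. ?m (B j)) = (\<Sum>j. \<Sum>i<n. emeasure (return borel (x i)) (B j)) / of_nat n"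
      by (simp add: ennreal_suminf_divide)
    also have "(\<Sum>j. \<Sum>i<n. emeasure (return borel (x i)) (B j))
        = (\<Sum>i<n. \<Sum>j. emeasure (return borel (x i)) (B j))"
      by (intro suminf_sum) simp
    also have "\<dots> = (\<Sum>i<n. emeasure (return borel (x i)) (\<Union>j. B j))"
      using B by (intro sum.cong refl suminf_emeasure) auto
    finally show "(\<Sum>j. ?m (B j)) = ?m (\<Union>j. B j)" .
  qed
  moreover have "positive (sets borel) ?m"
    by (simp add: positive_def)
  moreover have "sigma_algebra UNIV (sets borel :: 'a set set)"
    using sets.sigma_algebra_axioms[of borel] by (simp add: space_borel)
  ultimately have "emeasure (emp_measure n x) A = ?m A"
    unfolding emp_measure_def using A by (intro emeasure_measure_of_sigma)
  then show ?thesis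
    using A by simp
qed

lemma prob_space_emp_measure: "n > 0 \<Longrightarrow> prob_space (emp_measure n x)"
  by (intro prob_spaceI) (simp add: emeasure_emp_measure ennreal_divide_self of_nat_less_top)

end

theory Submission
  imports Defs "HOL-Real_Asymp.Real_Asymp"
begin

text \<open>
  Write \<open>W\<^sub>i\<close> for the coordinates on \<open>E\<^sup>n\<close>, which are independent with law \<open>\<mu>\<close>. The value at
  the empirical measure is the infimum over \<open>x\<close> of the sample means of \<open>h (x, W\<^sub>i)\<close>. A deviation
  of this infimum from \<open>V(\<mu>)\<close> by \<open>\<epsilon>\<close> forces one of finitely many fixed functions to have a sample
  mean exceeding its expectation by \<open>\<epsilon> / 4\<close>:

  \<^item> If \<open>V(L\<^sub>n)\<close> is too large, then so is the sample mean of \<open>h (x\<^sub>0, W\<^sub>i)\<close> at a single point \<open>x\<^sub>0\<close>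
    that nearly attains \<open>V(\<mu>)\<close>.

  \<^item> If \<open>V(L\<^sub>n)\<close> is too small, consider the lower envelopes \<open>l\<^sub>U w = INF y\<in>U. h (y, w)\<close>. As a ball \<open>U\<close>
    shrinks to \<open>x\<close>, the expectation of \<open>l\<^sub>U\<close> tends to that of \<open>h (x, W)\<close>, which is at least \<open>V(\<mu>)\<close>
    (\<open>exists_ball_integral_INF\<close>). By compactness finitely many balls whose envelopes have expectation
    above \<open>V(\<mu>) - \<epsilon> / 4\<close> cover the parameter space, and the sample mean of one of these envelopes
    must be too small.

  All these functions are dominated by \<open>\<psi>\<close> plus a constant, hence have a finite \<open>q\<close>-th moment.

  It remains to bound the upper deviation probability of a sample mean by a multiple of \<open>n\<^sup>1\<^sup>-\<^sup>q\<close>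
  (\<open>iid_sum_tail\<close>). For centred \<open>g\<close> truncate at \<open>\<delta> n\<close>. The
  probability that some \<open>g W\<^sub>i\<close> exceeds \<open>\<delta> n\<close> is at most \<open>n E |g|\<^sup>q / (\<delta> n)\<^sup>q\<close>, which has the claimed order.
  The truncated sum is handled by a Chernoff bound with parameter \<open>l = a ln n / n\<close>, where
  \<open>a = (q - 1) / \<epsilon>\<close> makes \<open>exp (- l n \<epsilon>) = n\<^sup>1\<^sup>-\<^sup>q\<close>. The price is the exponential moment of the
  truncated variable, bounded by \<open>exp (l\<^sup>p e\<^bsup>l \<delta> n\<^esup> E |g|\<^sup>p)\<close> with \<open>p = min q 2\<close>. For small \<open>\<delta>\<close> its \<open>n\<close>-th power
  stays bounded, since \<open>p > 1\<close>. A polynomial moment bound on the whole sum would not do for \<open>q > 2\<close>: it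
  would only give the order \<open>n\<^bsup>-q/2\<^esup>\<close>.
\<close>

section \<open>Exponential moments of truncated variables\<close>

lemma exp_le_quadratic:
  fixes u :: real
  assumes "\<bar>u\<bar> \<le> 1"
  shows "exp u \<le> 1 + u + u\<^sup>2"
proof (cases "u \<ge> 0")
  case True
  then show ?thesis using assms by (intro exp_bound) auto
next
  case False
  define x where "x = - u"
  have x: "x \<ge> 0" using False by (simp add: x_def)
  have "1 \<le> 1 + x\<^sup>2 / 2 + x ^ 3 / 2 + x ^ 4 / 2" using x by simp
  also have "\<dots> = (1 - x + x\<^sup>2) * (1 + x + x\<^sup>2 / 2)" by (simp add: field_simps power_numeral_reduce)
  also have "\<dots> \<le> (1 - x + x\<^sup>2) * exp x"
    using x assms by (intro mult_left_mono exp_lower_Taylor_quadratic) (auto simp: x_def)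
  finally have "1 * exp u \<le> (1 - x + x\<^sup>2) * exp x * exp u" by (intro mult_right_mono) auto
  then show ?thesis by (simp add: x_def mult.assoc flip: exp_add)
qed

text \<open>
  The exponent \<open>p\<close> interpolates between the linear and the quadratic remainder, so that variables
  without a second moment are covered. The factor \<open>exp b\<close> needs only an upper bound on \<open>u\<close>, which
  allows truncation from above alone.
\<close>

lemma exp_le_truncated:
  fixes u b p :: real
  assumes "u \<le> b" "0 \<le> b" "1 \<le> p" "p \<le> 2"
  shows "exp u \<le> 1 + u + \<bar>u\<bar> powr p * exp b"
proof (cases "\<bar>u\<bar> \<le> 1")
  case True
  have "exp u \<le> 1 + u + u\<^sup>2" using True by (rule exp_le_quadratic)
  also have "u\<^sup>2 \<le> \<bar>u\<bar> powr p"
  proof (cases "u = 0")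
    case False
    then show ?thesis using True assms powr_mono'[of p 2 "\<bar>u\<bar>"] by simp
  qed simp
  also have "\<bar>u\<bar> powr p \<le> \<bar>u\<bar> powr p * exp b"
    using assms by (simp add: mult_le_cancel_left1)
  finally show ?thesis by simp
next
  case False
  then have p: "\<bar>u\<bar> powr 1 \<le> \<bar>u\<bar> powr p"
    using assms by (intro powr_mono) auto
  show ?thesis
  proof (cases "u > 0")
    case True
    then have "exp u \<le> exp b * 1" using assms by simp
    also have "\<dots> \<le> exp b * \<bar>u\<bar> powr p" using p False by (intro mult_left_mono) auto
    finally show ?thesis using True by (simp add: mult.commute)
  next
    case u: False
    have "\<bar>u\<bar> powr p * 1 \<le> \<bar>u\<bar> powr p * exp b" using assms by (intro mult_left_mono) auto
    moreover have "exp u \<le> 1" "\<bar>u\<bar> powr 1 = - u" using u by simp_all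
    ultimately show ?thesis using p by linarith
  qed
qed

text \<open>
  Truncation from above by \<open>min\<close> can only lower a mean that is already nonpositive, so the linear
  term of the exponential can be dropped.
\<close>

lemma (in prob_space) nn_integral_exp_truncated_le:
  fixes g :: "'a \<Rightarrow> real"
  assumes [measurable]: "g \<in> borel_measurable M"
    and int: "integrable M g" "integrable M (\<lambda>w. \<bar>g w\<bar> powr p)"
    and "expectation g \<le> 0" "1 \<le> p" "p \<le> 2" "0 \<le> l" "0 \<le> b"
  shows "(\<integral>\<^sup>+ w. ennreal (exp (l * min (g w) b)) \<partial>M)
           \<le> ennreal (exp (l powr p * exp (l * b) * expectation (\<lambda>w. \<bar>g w\<bar> powr p)))"
proof -
  define c where "c = l powr p * exp (l * b)"
  have "exp (l * min (g w) b) \<le> 1 + l * min (g w) b + \<bar>l * min (g w) b\<bar> powr p * exp (l * b)" for w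
    using assms by (intro exp_le_truncated mult_left_mono mult_nonneg_nonneg) auto
  also have "1 + l * min (g w) b + \<bar>l * min (g w) b\<bar> powr p * exp (l * b)
      \<le> 1 + l * g w + \<bar>l * g w\<bar> powr p * exp (l * b)" for w
    using assms by (intro add_mono mult_right_mono mult_left_mono powr_mono2) (auto simp: abs_mult intro!: mult_left_mono)
  also have "\<bar>l * g w\<bar> powr p * exp (l * b) = c * \<bar>g w\<bar> powr p" for w
    using assms by (simp add: c_def abs_mult powr_mult)
  finally have pw: "exp (l * min (g w) b) \<le> 1 + l * g w + c * \<bar>g w\<bar> powr p" for w .
  have nonneg: "0 \<le> 1 + l * g w + c * \<bar>g w\<bar> powr p" for w
    using exp_ge_zero order_trans pw by blast
  have "(\<integral>\<^sup>+ w. ennreal (exp (l * min (g w) b)) \<partial>M)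
      \<le> (\<integral>\<^sup>+ w. ennreal (1 + l * g w + c * \<bar>g w\<bar> powr p) \<partial>M)"
    by (intro nn_integral_mono ennreal_leI pw)
  also have "\<dots> = ennreal (\<integral> w. 1 + l * g w + c * \<bar>g w\<bar> powr p \<partial>M)"
    using int nonneg by (intro nn_integral_eq_integral) auto
  also have "(\<integral> w. 1 + l * g w + c * \<bar>g w\<bar> powr p \<partial>M)
      = 1 + l * expectation g + c * expectation (\<lambda>w. \<bar>g w\<bar> powr p)"
    using int by (simp add: prob_space)
  also have "\<dots> \<le> 1 + c * expectation (\<lambda>w. \<bar>g w\<bar> powr p)"
    using assms by (simp add: mult_nonneg_nonpos)
  also have "\<dots> \<le> exp (c * expectation (\<lambda>w. \<bar>g w\<bar> powr p))"
    by (rule exp_ge_add_one_self)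
  finally show ?thesis by (simp add: c_def ennreal_leI)
qed

section \<open>Bounds for independent copies\<close>

lemma (in prob_space) iid_Chernoff_bound:
  fixes f :: "'a \<Rightarrow> real"
  assumes [measurable]: "f \<in> borel_measurable M"
    and mgf: "(\<integral>\<^sup>+ w. ennreal (exp (l * f w)) \<partial>M) \<le> ennreal (exp c)" and "0 \<le> l"
  shows "measure (\<Pi>\<^sub>M i\<in>{..<n}. M) {x \<in> space (\<Pi>\<^sub>M i\<in>{..<n}. M). t \<le> (\<Sum>i<n. f (x i))}
           \<le> exp (real n * c - l * t)"
proof -
  let ?P = "\<Pi>\<^sub>M i\<in>{..<n}. M"
  interpret P: finite_product_prob_space "\<lambda>_. M" "{..<n}"
    by unfold_locales auto
  let ?A = "{x \<in> space ?P. t \<le> (\<Sum>i<n. f (x i))}"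
  have "emeasure ?P ?A \<le> emeasure ?P {x \<in> space ?P. 1 \<le> ennreal (exp (- l * t)) * (\<Prod>i<n. ennreal (exp (l * f (x i))))}"
  proof (intro emeasure_mono)
    show "?A \<subseteq> {x \<in> space ?P. 1 \<le> ennreal (exp (- l * t)) * (\<Prod>i<n. ennreal (exp (l * f (x i))))}"
    proof safe
      fix x assume "t \<le> (\<Sum>i<n. f (x i))"
      then have "l * t \<le> l * (\<Sum>i<n. f (x i))" using assms by (intro mult_left_mono)
      then have "1 \<le> exp (- l * t + (\<Sum>i<n. l * f (x i)))" by (simp add: sum_distrib_left)
      also have "\<dots> = exp (- l * t) * (\<Prod>i<n. exp (l * f (x i)))" by (simp only: exp_add exp_sum finite_lessThan)
      finally show "1 \<le> ennreal (exp (- l * t)) * (\<Prod>i<n. ennreal (exp (l * f (x i))))"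
        by (simp add: prod_ennreal prod_nonneg flip: ennreal_mult ennreal_1)
    qed
  qed measurable
  also have "\<dots> \<le> ennreal (exp (- l * t)) * (\<integral>\<^sup>+ x. (\<Prod>i<n. ennreal (exp (l * f (x i)))) * indicator (space ?P) x \<partial>?P)"
    by (intro nn_integral_Markov_inequality) measurable
  also have "(\<integral>\<^sup>+ x. (\<Prod>i<n. ennreal (exp (l * f (x i)))) * indicator (space ?P) x \<partial>?P)
      = (\<integral>\<^sup>+ x. (\<Prod>i<n. ennreal (exp (l * f (x i)))) \<partial>?P)"
    by (intro nn_integral_cong) simp
  also have "\<dots> = (\<Prod>i<n. \<integral>\<^sup>+ w. ennreal (exp (l * f w)) \<partial>M)"
    by (intro P.product_nn_integral_prod) auto
  also have "\<dots> \<le> (\<Prod>i<n. ennreal (exp c))"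
    using mgf by (intro prod_mono_ennreal)
  also have "\<dots> = ennreal (exp (real n * c))" by (simp add: ennreal_power exp_of_nat_mult)
  finally have "emeasure ?P ?A \<le> ennreal (exp (- l * t)) * ennreal (exp (real n * c))"
    by (rule order_trans) (rule mult_left_mono, auto)
  also have "ennreal (exp (- l * t)) * ennreal (exp (real n * c)) = ennreal (exp (real n * c - l * t))"
    by (simp add: exp_diff exp_minus divide_inverse mult.commute flip: ennreal_mult)
  finally show ?thesis
    by (simp add: P.emeasure_eq_measure)
qed

lemma (in prob_space) iid_union_bound:
  assumes [measurable]: "Measurable.pred M Q"
  shows "measure (\<Pi>\<^sub>M i\<in>{..<n}. M) {x \<in> space (\<Pi>\<^sub>M i\<in>{..<n}. M). \<exists>i<n. Q (x i)}
           \<le> real n * measure M {w \<in> space M. Q w}"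
proof -
  let ?P = "\<Pi>\<^sub>M i\<in>{..<n}. M"
  let ?E = "\<lambda>i. (\<lambda>x. x i) -` {w \<in> space M. Q w} \<inter> space ?P"
  interpret P: finite_product_prob_space "\<lambda>_. M" "{..<n}"
    by unfold_locales auto
  have comp: "(\<lambda>x. x i) \<in> ?P \<rightarrow>\<^sub>M M" if "i < n" for i
    using that by (intro measurable_component_singleton) simp
  have Q: "{w \<in> space M. Q w} \<in> sets M" by measurable
  have "{x \<in> space ?P. \<exists>i<n. Q (x i)} = (\<Union>i<n. ?E i)"
    by (auto simp: space_PiM)
  also have "measure ?P (\<Union>i<n. ?E i) \<le> (\<Sum>i<n. measure ?P (?E i))"
    using measurable_sets[OF comp Q] by (intro measure_UNION_le) auto
  also have "\<dots> = (\<Sum>i<n. measure M {w \<in> space M. Q w})"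
  proof (intro sum.cong refl)
    fix i assume i: "i \<in> {..<n}"
    have "measure ?P (?E i) = measure (distr ?P M (\<lambda>x. x i)) {w \<in> space M. Q w}"
      using comp Q i by (intro measure_distr[symmetric]) auto
    also have "distr ?P M (\<lambda>x. x i) = M"
      using i by (intro distr_PiM_component prob_space_axioms)
    finally show "measure ?P (?E i) = measure M {w \<in> space M. Q w}" .
  qed
  finally show ?thesis by simp
qed

section \<open>Moments\<close>

lemma (in finite_measure) integrable_abs_powr_mono:
  fixes g :: "'a \<Rightarrow> real"
  assumes [measurable]: "g \<in> borel_measurable M"
    and int: "integrable M (\<lambda>w. \<bar>g w\<bar> powr q)" and r: "0 \<le> r" "r \<le> q"
  shows "integrable M (\<lambda>w. \<bar>g w\<bar> powr r)"
proof (rule Bochner_Integration.integrable_bound)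
  show "integrable M (\<lambda>w. 1 + \<bar>g w\<bar> powr q)" using int by simp
  have "\<bar>y\<bar> powr r \<le> 1 + \<bar>y\<bar> powr q" for y :: real
  proof (cases "\<bar>y\<bar> \<le> 1")
    case True
    then have "\<bar>y\<bar> powr r \<le> 1" using r by (simp add: powr_le1)
    then show ?thesis by (simp add: add_increasing2)
  next
    case False
    then have "\<bar>y\<bar> powr r \<le> \<bar>y\<bar> powr q" using r by (intro powr_mono) auto
    then show ?thesis by simp
  qed
  then show "AE w in M. norm (\<bar>g w\<bar> powr r) \<le> norm (1 + \<bar>g w\<bar> powr q)" by simp
qed measurable

lemma (in finite_measure) integrable_of_abs_powr:
  fixes g :: "'a \<Rightarrow> real"
  assumes g: "g \<in> borel_measurable M" and int: "integrable M (\<lambda>w. \<bar>g w\<bar> powr q)" and "1 \<le> q"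
  shows "integrable M g"
proof (rule integrable_abs_cancel[OF _ g])
  show "integrable M (\<lambda>w. \<bar>g w\<bar>)"
    using integrable_abs_powr_mono[OF g int, of 1] \<open>1 \<le> q\<close> by simp
qed

lemma abs_add_powr_le:
  fixes a b q :: real
  assumes "0 \<le> q"
  shows "\<bar>a + b\<bar> powr q \<le> 2 powr q * (\<bar>a\<bar> powr q + \<bar>b\<bar> powr q)"
proof -
  have "\<bar>a + b\<bar> powr q \<le> (2 * max \<bar>a\<bar> \<bar>b\<bar>) powr q"
    using assms by (intro powr_mono2) auto
  also have "\<dots> = 2 powr q * max \<bar>a\<bar> \<bar>b\<bar> powr q" by (simp add: powr_mult)
  also have "\<dots> \<le> 2 powr q * (\<bar>a\<bar> powr q + \<bar>b\<bar> powr q)"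
    by (intro mult_left_mono) (auto simp: max_def)
  finally show ?thesis .
qed

section \<open>Tails of sums under a finite moment\<close>

text \<open>
  For \<open>p = 1 + 2 s\<close>, \<open>l = a ln n / n\<close> and \<open>e\<^bsup>l \<delta> n\<^esup> = n\<^sup>s\<close> this is, up to the factor \<open>a\<^sup>p\<close>, the quantity
  \<open>n l\<^sup>p e\<^bsup>l \<delta> n\<^esup>\<close> in the exponent of the Chernoff bound.
\<close>

lemma ln_powr_times_powr_tendsto_0:
  fixes s :: real
  assumes "s > 0"
  shows "(\<lambda>n::nat. ln (real n) powr (1 + 2 * s) * real n powr (-s)) \<longlonglongrightarrow> 0"
  using assms by real_asymp

text \<open>
  Either a single summand reaches the truncation level \<open>\<delta> n\<close>, which accounts for the order
  \<open>n\<^sup>1\<^sup>-\<^sup>q\<close>, or the sum of the truncated summands is large, which the Chernoff bound controls.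
\<close>

lemma (in prob_space) iid_sum_tail:
  fixes g :: "'a \<Rightarrow> real"
  assumes [measurable]: "g \<in> borel_measurable M"
    and q: "q > 1" and intq: "integrable M (\<lambda>w. \<bar>g w\<bar> powr q)"
    and mean: "expectation g \<le> 0" and "\<epsilon> > 0"
  shows "\<exists>C. \<forall>\<^sub>F n in sequentially. measure (\<Pi>\<^sub>M i\<in>{..<n}. M)
           {x \<in> space (\<Pi>\<^sub>M i\<in>{..<n}. M). real n * \<epsilon> \<le> (\<Sum>i<n. g (x i))} \<le> C * real n powr (1 - q)"
proof -
  \<comment> \<open>The choice of \<open>a\<close> makes \<open>exp (- l n \<epsilon>) = n\<^sup>1\<^sup>-\<^sup>q\<close> for \<open>l = a ln n / n\<close>, and the choice of \<open>\<delta>\<close>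
     makes \<open>exp (l \<delta> n) = n\<^sup>s\<close>, half of what the gain \<open>n\<^bsup>p - 1\<^esup>\<close> can absorb.\<close>
  define p where "p = min q 2"
  define s where "s = (p - 1) / 2"
  define a where "a = (q - 1) / \<epsilon>"
  define \<delta> where "\<delta> = s / a"
  have p: "1 < p" "p \<le> 2" "p \<le> q" and s: "s > 0" and a: "a > 0" and \<delta>: "\<delta> > 0"
    using q \<open>\<epsilon> > 0\<close> by (auto simp: p_def s_def a_def \<delta>_def)
  have intg: "integrable M g"
    using q intq by (intro integrable_of_abs_powr[of g q]) simp_all
  have intp: "integrable M (\<lambda>w. \<bar>g w\<bar> powr p)"
    using intq p by (intro integrable_abs_powr_mono[of g q p]) simp_all
  define K where "K = expectation (\<lambda>w. \<bar>g w\<bar> powr p)"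
  define Kq where "Kq = expectation (\<lambda>w. \<bar>g w\<bar> powr q)"
  have "(\<lambda>n::nat. K * a powr p * (ln (real n) powr (1 + 2 * s) * real n powr (- s))) \<longlonglongrightarrow> K * a powr p * 0"
    by (intro tendsto_mult_left ln_powr_times_powr_tendsto_0 s)
  then have "\<forall>\<^sub>F n in sequentially. K * a powr p * (ln (real n) powr (1 + 2 * s) * real n powr (- s)) < 1"
    by (rule order_tendstoD) simp
  then have "\<forall>\<^sub>F n in sequentially. measure (\<Pi>\<^sub>M i\<in>{..<n}. M)
      {x \<in> space (\<Pi>\<^sub>M i\<in>{..<n}. M). real n * \<epsilon> \<le> (\<Sum>i<n. g (x i))}
      \<le> (Kq / \<delta> powr q + exp 1) * real n powr (1 - q)"
    using eventually_gt_at_top[of 1]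
  proof eventually_elim
    case (elim n)
    let ?P = "\<Pi>\<^sub>M i\<in>{..<n}. M"
    interpret P: finite_product_prob_space "\<lambda>_. M" "{..<n}"
      by unfold_locales auto
    have n: "real n > 1" "ln (real n) > 0" using elim by auto
    define l where "l = a * ln (real n) / real n"
    define b where "b = \<delta> * real n"
    have l: "l > 0" and b: "b > 0" using n a \<delta> by (auto simp: l_def b_def)
    have lb: "exp (l * b) = real n powr s"
      using n a by (simp add: l_def b_def \<delta>_def powr_def)
    have "real n * (l powr p * exp (l * b) * K)
        = K * a powr p * (ln (real n) powr p * (real n powr 1 / real n powr p * real n powr s))"
      using n a unfolding lb unfolding l_def by (simp add: powr_mult powr_divide)
    also have "real n powr 1 / real n powr p * real n powr s = real n powr (- s)"
      unfolding powr_diff[symmetric] powr_add[symmetric]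
      by (rule arg_cong[where f = "\<lambda>t. real n powr t"]) (simp add: s_def field_simps)
    finally have eq: "real n * (l powr p * exp (l * b) * K)
        = K * a powr p * (ln (real n) powr p * real n powr (- s))" .
    have ps: "1 + 2 * s = p" by (simp add: s_def field_simps)
    have small: "real n * (l powr p * exp (l * b) * K) \<le> 1"
      using elim(1) unfolding eq ps by (rule less_imp_le)
    have le: "l * (real n * \<epsilon>) = (q - 1) * ln (real n)"
      using n \<open>\<epsilon> > 0\<close> by (simp add: l_def a_def)
    let ?A = "{x \<in> space ?P. real n * \<epsilon> \<le> (\<Sum>i<n. g (x i))}"
    let ?B = "{x \<in> space ?P. \<exists>i<n. b \<le> g (x i)}"
    let ?C = "{x \<in> space ?P. real n * \<epsilon> \<le> (\<Sum>i<n. min (g (x i)) b)}"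
    have "measure ?P ?A \<le> measure ?P (?B \<union> ?C)"
    proof (intro P.finite_measure_mono subsetI)
      fix x assume x: "x \<in> ?A"
      show "x \<in> ?B \<union> ?C"
      proof (cases "\<exists>i<n. b \<le> g (x i)")
        case False
        then have "(\<Sum>i<n. min (g (x i)) b) = (\<Sum>i<n. g (x i))"
          by (intro sum.cong) (auto simp: not_le)
        then show ?thesis using x by simp
      qed (use x in auto)
    qed measurable
    also have "\<dots> \<le> measure ?P ?B + measure ?P ?C"
      by (intro measure_Un_le) measurable
    finally have split: "measure ?P ?A \<le> measure ?P ?B + measure ?P ?C" .
    have "measure M {w \<in> space M. b \<le> g w} \<le> measure M {w \<in> space M. b powr q \<le> \<bar>g w\<bar> powr q}"
    proof (intro finite_measure_mono subsetI)
      fix w assume "w \<in> {w \<in> space M. b \<le> g w}"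
      then show "w \<in> {w \<in> space M. b powr q \<le> \<bar>g w\<bar> powr q}" using b q by (auto intro: powr_mono2)
    qed measurable
    also have "\<dots> \<le> Kq / b powr q"
      unfolding Kq_def using b intq
      by (intro integral_Markov_inequality_measure[where A = "space M"]) auto
    finally have "real n * measure M {w \<in> space M. b \<le> g w} \<le> real n * (Kq / b powr q)"
      by (intro mult_left_mono) auto
    moreover have "measure ?P ?B \<le> real n * measure M {w \<in> space M. b \<le> g w}"
      by (rule iid_union_bound) measurable
    moreover have "real n * (Kq / b powr q) = Kq / \<delta> powr q * real n powr (1 - q)"
      unfolding b_def powr_mult powr_diff using n by simp
    ultimately have B: "measure ?P ?B \<le> Kq / \<delta> powr q * real n powr (1 - q)" by linarith
    have "measure ?P ?C \<le> exp (real n * (l powr p * exp (l * b) * K) - l * (real n * \<epsilon>))"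
      unfolding K_def using l b p intg intp mean
      by (intro iid_Chernoff_bound nn_integral_exp_truncated_le) auto
    also have "\<dots> \<le> exp (1 + (1 - q) * ln (real n))"
    proof -
      have "(q - 1) * ln (real n) = - ((1 - q) * ln (real n))" by (simp add: minus_mult_left)
      then show ?thesis using small le unfolding exp_le_cancel_iff by linarith
    qed
    also have "\<dots> = exp 1 * real n powr (1 - q)"
      using n by (simp add: exp_add powr_def)
    finally show ?case using split B unfolding distrib_right by linarith
  qed
  then show ?thesis by blast
qed

lemma (in prob_space) iid_mean_tail:
  fixes f :: "'a \<Rightarrow> real"
  assumes [measurable]: "f \<in> borel_measurable M"
    and q: "q > 1" and intq: "integrable M (\<lambda>w. \<bar>f w\<bar> powr q)" and "\<epsilon> > 0"
  shows "\<exists>C. \<forall>\<^sub>F n in sequentially. measure (\<Pi>\<^sub>M i\<in>{..<n}. M)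
           {x \<in> space (\<Pi>\<^sub>M i\<in>{..<n}. M). real n * (expectation f + \<epsilon>) \<le> (\<Sum>i<n. f (x i))}
             \<le> C * real n powr (1 - q)"
proof -
  let ?g = "\<lambda>w. f w - expectation f"
  have int: "integrable M f"
    using intq q by (intro integrable_of_abs_powr[of f q]) simp_all
  have bound: "\<bar>?g w\<bar> powr q \<le> 2 powr q * (\<bar>f w\<bar> powr q + \<bar>expectation f\<bar> powr q)" for w
    using abs_add_powr_le[of q "f w" "- expectation f"] q by simp
  have "integrable M (\<lambda>w. \<bar>?g w\<bar> powr q)"
  proof (rule Bochner_Integration.integrable_bound)
    show "integrable M (\<lambda>w. 2 powr q * (\<bar>f w\<bar> powr q + \<bar>expectation f\<bar> powr q))" using intq by simp
    show "AE w in M. norm (\<bar>?g w\<bar> powr q) \<le> norm (2 powr q * (\<bar>f w\<bar> powr q + \<bar>expectation f\<bar> powr q))"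
      using bound by (intro AE_I2) simp
  qed measurable
  moreover have "expectation ?g \<le> 0" using int by (simp add: prob_space)
  ultimately have "\<exists>C. \<forall>\<^sub>F n in sequentially. measure (\<Pi>\<^sub>M i\<in>{..<n}. M)
           {x \<in> space (\<Pi>\<^sub>M i\<in>{..<n}. M). real n * \<epsilon> \<le> (\<Sum>i<n. ?g (x i))} \<le> C * real n powr (1 - q)"
    using q \<open>\<epsilon> > 0\<close> by (intro iid_sum_tail) measurable
  moreover have "real n * \<epsilon> \<le> (\<Sum>i<n. ?g (x i)) \<longleftrightarrow> real n * (expectation f + \<epsilon>) \<le> (\<Sum>i<n. f (x i))" for n x
    by (simp add: sum_subtractf distrib_left algebra_simps)
  ultimately show ?thesis by simp
qed

section \<open>Integrals against the empirical measure\<close>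

lemma ext_integral_eq_integral:
  assumes "integrable M f"
  shows "ext_integral M f = ereal (\<integral>w. f w \<partial>M)"
proof -
  have "(\<integral>\<^sup>+ w. ennreal (f w) \<partial>M) \<noteq> \<infinity>" "(\<integral>\<^sup>+ w. ennreal (- f w) \<partial>M) \<noteq> \<infinity>"
    using assms by (auto simp: real_integrable_def)
  then obtain a b where ab: "a \<ge> 0" "(\<integral>\<^sup>+ w. ennreal (f w) \<partial>M) = ennreal a"
    "b \<ge> 0" "(\<integral>\<^sup>+ w. ennreal (- f w) \<partial>M) = ennreal b"
    by (metis ennreal_cases infinity_ennreal_def)
  then show ?thesis
    unfolding ext_integral_def real_lebesgue_integral_def[OF assms] by simp
qed

text \<open>
  The empirical measure is the law of a uniformly chosen sample point, which gives access to the
  integration theory of finite distributions.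
\<close>

lemma emp_measure_eq_distr:
  assumes "n > 0"
  shows "emp_measure n x = distr (measure_pmf (pmf_of_set {..<n})) borel x"
proof (rule measure_eqI)
  fix A assume "A \<in> sets (emp_measure n x)"
  then have A: "A \<in> sets borel" by simp
  have "emeasure (distr (measure_pmf (pmf_of_set {..<n})) borel x) A
      = ennreal (real (card ({..<n} \<inter> x -` A)) / real n)"
    using assms A emeasure_pmf_of_set[of "{..<n}" "x -` A"]
    by (simp add: emeasure_distr lessThan_empty_iff)
  also have "\<dots> = of_nat (card ({..<n} \<inter> x -` A)) / of_nat n"
    using assms by (simp add: divide_ennreal[symmetric] ennreal_of_nat_eq_real_of_nat)
  also have "of_nat (card ({..<n} \<inter> x -` A)) = (\<Sum>i<n. indicator A (x i) :: ennreal)"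
    by (simp add: indicator_def sum.If_cases vimage_def)
  finally show "emeasure (emp_measure n x) A = emeasure (distr (measure_pmf (pmf_of_set {..<n})) borel x) A"
    using A by (simp add: emeasure_emp_measure)
qed simp

lemma ext_integral_emp_measure:
  assumes "n > 0" and f: "f \<in> borel_measurable borel"
  shows "ext_integral (emp_measure n x) f = ereal ((\<Sum>i<n. f (x i)) / real n)"
proof -
  have ne: "{..<n} \<noteq> {}" using assms by (auto simp: lessThan_empty_iff)
  have "integrable (measure_pmf (pmf_of_set {..<n})) (\<lambda>i. f (x i))"
    using ne by (intro integrable_measure_pmf_finite) (simp add: set_pmf_of_set)
  then have "integrable (emp_measure n x) f"
    using f assms by (simp add: emp_measure_eq_distr integrable_distr_eq)
  then show ?thesis
    using f assms ne by (simp add: ext_integral_eq_integral emp_measure_eq_distr integral_distr integral_pmf_of_set)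
qed

lemma inf_val_eq:
  assumes "\<And>x. ext_integral \<nu> (\<lambda>w. h (x, w)) = ereal (I x)" and "bdd_below (range I)"
  shows "inf_val h \<nu> = ereal (INF x. I x)"
proof -
  obtain B where B: "\<And>x. B \<le> I x" using assms(2) by (auto simp: bdd_below_def)
  have "ereal B \<le> (INF x. ereal (I x))" using B by (intro INF_greatest) simp
  moreover have "(INF x. ereal (I x)) \<le> ereal (I undefined)" by (intro INF_lower) simp
  ultimately have "\<bar>INF x. ereal (I x)\<bar> \<noteq> \<infinity>" by auto
  then have "ereal (INF x. I x) = (INF x. ereal (I x))" by (rule ereal_INF)
  then show ?thesis unfolding inf_val_def assms(1) by simp
qed

section \<open>Envelopes of continuous families\<close>

text \<open>
  The index set may be uncountable: measurability comes from the strict sublevel sets of the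
  infimum being unions of open sets.
\<close>

lemma borel_measurable_INF_continuous:
  fixes h :: "'a \<Rightarrow> 'b::topological_space \<Rightarrow> real"
  assumes "\<And>x. x \<in> A \<Longrightarrow> continuous_on UNIV (h x)" "A \<noteq> {}" "\<And>w. bdd_below ((\<lambda>x. h x w) ` A)"
  shows "(\<lambda>w. INF x\<in>A. h x w) \<in> borel_measurable borel"
proof (rule borel_measurableI_less)
  fix y
  have "{w \<in> space borel. (INF x\<in>A. h x w) < y} = (\<Union>x\<in>A. {w. h x w < y})"
    using assms(2,3) by (auto simp: cINF_less_iff)
  moreover have "open (\<Union>x\<in>A. {w. h x w < y})"
    using assms(1) by (intro open_UN ballI open_Collect_less continuous_on_const) auto
  ultimately show "{w \<in> space borel. (INF x\<in>A. h x w) < y} \<in> sets borel" by simp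
qed

lemma borel_measurable_SUP_continuous:
  fixes h :: "'a \<Rightarrow> 'b::topological_space \<Rightarrow> real"
  assumes "\<And>x. x \<in> A \<Longrightarrow> continuous_on UNIV (h x)" "A \<noteq> {}" "\<And>w. bdd_above ((\<lambda>x. h x w) ` A)"
  shows "(\<lambda>w. SUP x\<in>A. h x w) \<in> borel_measurable borel"
proof (rule borel_measurableI_greater)
  fix y
  have "{w \<in> space borel. y < (SUP x\<in>A. h x w)} = (\<Union>x\<in>A. {w. y < h x w})"
    using assms(2,3) by (auto simp: less_cSUP_iff)
  moreover have "open (\<Union>x\<in>A. {w. y < h x w})"
    using assms(1) by (intro open_UN ballI open_Collect_less continuous_on_const) auto
  ultimately show "{w \<in> space borel. y < (SUP x\<in>A. h x w)} \<in> sets borel" by simp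
qed

lemma tendsto_INF_ball:
  fixes f :: "'a::metric_space \<Rightarrow> real"
  assumes cont: "continuous (at x) f" and below: "bdd_below (range f)"
  shows "(\<lambda>k. INF y\<in>ball x (1 / Suc k). f y) \<longlonglongrightarrow> f x"
proof (rule LIMSEQ_I)
  fix r :: real assume "r > 0"
  obtain d where d: "d > 0" "\<And>y. dist y x < d \<Longrightarrow> dist (f y) (f x) < r / 2"
    using cont \<open>r > 0\<close> unfolding continuous_at_eps_delta by (metis half_gt_zero)
  obtain N where N: "1 / real (Suc N) < d" using nat_approx_posE[OF d(1)] by blast
  have "norm ((INF y\<in>ball x (1 / Suc k). f y) - f x) < r" if "k \<ge> N" for k
  proof -
    have "1 / real (Suc k) \<le> 1 / real (Suc N)" using that by (simp add: frac_le)
    then have "1 / real (Suc k) < d" using N by linarith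
    then have "f x - r / 2 \<le> f y" if "y \<in> ball x (1 / Suc k)" for y
    proof -
      have "dist y x < d" using that \<open>1 / real (Suc k) < d\<close> unfolding mem_ball dist_commute[of x] by linarith
      then have "\<bar>f y - f x\<bar> < r / 2" using d(2) unfolding dist_real_def by blast
      then show ?thesis by linarith
    qed
    then have "f x - r / 2 \<le> (INF y\<in>ball x (1 / Suc k). f y)"
      by (intro cINF_greatest) auto
    moreover have "(INF y\<in>ball x (1 / Suc k). f y) \<le> f x"
      by (intro cINF_lower bdd_below_mono[OF below]) auto
    ultimately show ?thesis using \<open>r > 0\<close> by simp
  qed
  then show "\<exists>N. \<forall>k\<ge>N. norm ((INF y\<in>ball x (1 / Suc k). f y) - f x) < r" by blast
qed

text \<open>
  The local lower envelopes increase to \<open>h (x, w)\<close> as the ball shrinks, and they lie between the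
  global lower bound and \<open>h (x, w)\<close>, so dominated convergence applies.
\<close>

lemma exists_ball_integral_INF:
  fixes h :: "'x::metric_space \<times> 'e::topological_space \<Rightarrow> real"
  assumes "finite_measure M" and sets: "sets M = sets borel" and cont: "continuous_on UNIV h" and below: "\<And>z. B \<le> h z"
    and int: "integrable M (\<lambda>w. h (x, w))" and c: "c < (\<integral>w. h (x, w) \<partial>M)"
  shows "\<exists>r>0. c < (\<integral>w. (INF y\<in>ball x r. h (y, w)) \<partial>M)"
proof -
  interpret finite_measure M by fact
  let ?l = "\<lambda>k w. INF y\<in>ball x (1 / Suc k). h (y, w)"
  have bdd: "bdd_below ((\<lambda>y. h (y, w)) ` A)" for w A
    by (rule bdd_belowI2[where m = B]) (rule below)
  have "(\<lambda>k. \<integral>w. ?l k w \<partial>M) \<longlonglongrightarrow> (\<integral>w. h (x, w) \<partial>M)"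
  proof (rule integral_dominated_convergence[where w = "\<lambda>w. \<bar>B\<bar> + \<bar>h (x, w)\<bar>"])
    show "(\<lambda>w. h (x, w)) \<in> borel_measurable M" using int by simp
    show "?l k \<in> borel_measurable M" for k
      unfolding measurable_cong_sets[OF sets refl]
      by (intro borel_measurable_INF_continuous bdd)
         (auto intro!: continuous_on_compose2[OF cont] continuous_intros)
    show "integrable M (\<lambda>w. \<bar>B\<bar> + \<bar>h (x, w)\<bar>)" using int by simp
    show "AE w in M. (\<lambda>k. ?l k w) \<longlonglongrightarrow> h (x, w)"
    proof (intro AE_I2 tendsto_INF_ball bdd)
      fix w
      have "continuous_on UNIV (\<lambda>y. h (y, w))"
        by (intro continuous_on_compose2[OF cont] continuous_intros) auto
      then show "continuous (at x) (\<lambda>y. h (y, w))"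
        by (simp add: continuous_on_eq_continuous_at)
    qed
    fix k
    have "norm (?l k w) \<le> \<bar>B\<bar> + \<bar>h (x, w)\<bar>" for w
    proof -
      have "B \<le> ?l k w" by (intro cINF_greatest below) auto
      moreover have "?l k w \<le> h (x, w)" by (intro cINF_lower bdd) auto
      ultimately show ?thesis by simp
    qed
    then show "AE w in M. norm (?l k w) \<le> \<bar>B\<bar> + \<bar>h (x, w)\<bar>" by simp
  qed
  then have "\<forall>\<^sub>F k in sequentially. c < (\<integral>w. ?l k w \<partial>M)"
    using c by (rule order_tendstoD)
  then obtain k where "c < (\<integral>w. ?l k w \<partial>M)" by (auto simp: eventually_sequentially)
  then show ?thesis by (intro exI[of _ "1 / real (Suc k)"]) simp
qed

section \<open>Deviations of the optimal value\<close>

theorem theorem1p5: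
  fixes h :: "'x::polish_space \<times> 'e::polish_space \<Rightarrow> real"
    and \<mu> :: "'e measure" and q \<epsilon> :: real
  assumes "compact (UNIV :: 'x set)"
    and "continuous_on UNIV h"
    and "bdd_below (range h)"
    and "\<And>c. compact {(x, w). h (x, w) \<le> c}"
    and "q > 1"
    and "prob_space \<mu>" and "sets \<mu> = sets borel"
    and "(\<integral>\<^sup>+ w. ennreal (sup_pos h w powr q) \<partial>\<mu>) < \<infinity>"
    and "\<epsilon> > 0"
  shows "limsup (\<lambda>n. ereal (real n powr (q - 1) *
           measure (\<Pi>\<^sub>M i\<in>{..<n}. \<mu>)
             {x \<in> space (\<Pi>\<^sub>M i\<in>{..<n}. \<mu>).
               \<bar>inf_val h (emp_measure n x) - inf_val h \<mu>\<bar> \<ge> ereal \<epsilon>})) < \<infinity>"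
proof -
  note compact = assms(1) and cont = assms(2) and q = assms(5) and sets = assms(7)
  interpret prob_space \<mu> by fact
  have borel: "f \<in> borel_measurable \<mu> \<longleftrightarrow> f \<in> borel_measurable borel" for f :: "'e \<Rightarrow> real"
    by (simp add: measurable_cong_sets[OF sets refl])
  obtain B where B: "\<And>z. B \<le> h z" using assms(3) by (auto simp: bdd_below_def)
  have cont_w: "continuous_on UNIV (\<lambda>w. h (x, w))" for x
    by (intro continuous_on_compose2[OF cont] continuous_intros) auto
  have cont_x: "continuous_on UNIV (\<lambda>x. h (x, w))" for w
    by (intro continuous_on_compose2[OF cont] continuous_intros) auto
  have bdd: "bdd_below ((\<lambda>y. h (y, w)) ` A)" for w A
    by (rule bdd_belowI2[where m = B]) (rule B)
  have bdd': "bdd_above (range (\<lambda>y. h (y, w)))" for w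
    by (intro bounded_imp_bdd_above compact_imp_bounded compact_continuous_image cont_x compact)
  have h_meas: "(\<lambda>w. h (x, w)) \<in> borel_measurable borel" for x
    by (intro borel_measurable_continuous_onI cont_w)
  have h_le: "h (x, w) \<le> sup_pos h w" for x w
    unfolding sup_pos_def by (intro max.coboundedI1 cSUP_upper bdd') simp
  have \<psi>_meas [measurable]: "sup_pos h \<in> borel_measurable \<mu>"
    unfolding borel sup_pos_def[abs_def]
    by (intro borel_measurable_max borel_measurable_const borel_measurable_SUP_continuous cont_w bdd') simp
  have \<psi>_int: "integrable \<mu> (\<lambda>w. sup_pos h w powr q)"
    using assms(8) by (intro integrableI_nonneg) auto
  have intq: "integrable \<mu> (\<lambda>w. \<bar>f w\<bar> powr q)"
    if f: "f \<in> borel_measurable \<mu>" "\<And>w. \<bar>f w\<bar> \<le> sup_pos h w + \<bar>B\<bar>" for f :: "'e \<Rightarrow> real"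
  proof (rule Bochner_Integration.integrable_bound)
    show "integrable \<mu> (\<lambda>w. 2 powr q * (sup_pos h w powr q + \<bar>B\<bar> powr q))"
      using \<psi>_int by simp
    have "\<bar>f w\<bar> powr q \<le> 2 powr q * (sup_pos h w powr q + \<bar>B\<bar> powr q)" for w
    proof -
      have "0 \<le> sup_pos h w" by (simp add: sup_pos_def)
      have "\<bar>f w\<bar> powr q \<le> \<bar>sup_pos h w + \<bar>B\<bar>\<bar> powr q"
        using f(2)[of w] q by (intro powr_mono2) auto
      also have "\<dots> \<le> 2 powr q * (sup_pos h w powr q + \<bar>B\<bar> powr q)"
        using abs_add_powr_le[of q "sup_pos h w" "\<bar>B\<bar>"] q \<open>0 \<le> sup_pos h w\<close> by simp
      finally show ?thesis .
    qed
    then show "AE w in \<mu>. norm (\<bar>f w\<bar> powr q) \<le> norm (2 powr q * (sup_pos h w powr q + \<bar>B\<bar> powr q))"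
      by simp
    show "(\<lambda>w. \<bar>f w\<bar> powr q) \<in> borel_measurable \<mu>" using f(1) by measurable
  qed

  have h_abs: "\<bar>h (x, w)\<bar> \<le> sup_pos h w + \<bar>B\<bar>" for x w
    using h_le[of x w] B[of "(x, w)"] by (auto simp: sup_pos_def)
  have h_intq: "integrable \<mu> (\<lambda>w. \<bar>h (x, w)\<bar> powr q)" for x
    by (rule intq) (simp_all add: borel h_meas h_abs)
  have h_int: "integrable \<mu> (\<lambda>w. h (x, w))" for x
    by (rule integrable_of_abs_powr[OF _ h_intq]) (use q in \<open>simp_all add: borel h_meas\<close>)
  define I where "I x = expectation (\<lambda>w. h (x, w))" for x
  define v where "v = (INF x. I x)"
  have I_ge: "B \<le> I x" for x
    unfolding I_def using B h_int by (intro integral_ge_const) auto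
  have bddI: "bdd_below (range I)"
    by (rule bdd_belowI2[where m = B]) (rule I_ge)
  have V\<mu>: "inf_val h \<mu> = ereal v"
    unfolding v_def by (intro inf_val_eq bddI) (simp add: I_def ext_integral_eq_integral h_int)
  define J where "J n y x = (\<Sum>i<n. h (x, y i)) / real n" for n x and y :: "nat \<Rightarrow> 'e"
  have J_ge: "B \<le> J n y x" if "n > 0" for n y x
  proof -
    have "real n * B \<le> (\<Sum>i<n. h (x, y i))"
      using sum_mono[of "{..<n}" "\<lambda>_. B" "\<lambda>i. h (x, y i)"] B by simp
    then show ?thesis using that by (simp add: J_def field_simps)
  qed
  have bddJ: "bdd_below (range (J n y))" if "n > 0" for n y
    by (rule bdd_belowI2[where m = B]) (rule J_ge[OF that])
  have Vemp: "inf_val h (emp_measure n y) = ereal (INF x. J n y x)" if "n > 0" for n y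
    using that by (intro inf_val_eq bddJ) (simp_all add: J_def ext_integral_emp_measure h_meas)

  \<comment> \<open>The point whose sample mean detects that the empirical value is too large.\<close>
  obtain x0 where x0: "I x0 < v + \<epsilon> / 2"
    using cINF_less_iff[OF _ bddI, of "v + \<epsilon> / 2"] \<open>\<epsilon> > 0\<close> by (auto simp: v_def)

  \<comment> \<open>A finite cover by balls whose lower envelopes detect that it is too small.\<close>
  have "\<exists>r>0. v - \<epsilon> / 4 < expectation (\<lambda>w. INF y\<in>ball x r. h (y, w))" for x
  proof (rule exists_ball_integral_INF[OF _ sets cont B h_int])
    have "v \<le> I x" unfolding v_def by (intro cINF_lower bddI) simp
    then show "v - \<epsilon> / 4 < expectation (\<lambda>w. h (x, w))" using \<open>\<epsilon> > 0\<close> by (simp add: I_def)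
  qed unfold_locales
  then obtain r where r: "\<And>x. r x > 0"
    "\<And>x. v - \<epsilon> / 4 < expectation (\<lambda>w. INF y\<in>ball x (r x). h (y, w))"
    by metis
  obtain S where S: "finite S" "UNIV \<subseteq> (\<Union>x\<in>S. ball x (r x))"
    by (rule compactE_image[OF compact, of UNIV "\<lambda>x. ball x (r x)"]) (use r(1) in auto)
  define l where "l x w = (INF y\<in>ball x (r x). h (y, w))" for x w
  have l_meas: "l x \<in> borel_measurable \<mu>" for x
    unfolding borel l_def[abs_def] using r(1)[of x]
    by (intro borel_measurable_INF_continuous cont_w bdd) auto
  have l_ge: "B \<le> l x w" for x w
    unfolding l_def using r(1)[of x] by (intro cINF_greatest B) auto
  have l_le: "l x w \<le> h (y, w)" if "y \<in> ball x (r x)" for x y w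
    unfolding l_def using that by (intro cINF_lower bdd)
  have l_intq: "integrable \<mu> (\<lambda>w. \<bar>l x w\<bar> powr q)" for x
  proof (rule intq[OF l_meas])
    fix w
    have "l x w \<le> h (x, w)" using r(1)[of x] by (intro l_le) simp
    then show "\<bar>l x w\<bar> \<le> sup_pos h w + \<bar>B\<bar>"
      using h_le[of x w] l_ge[of x w] by (auto simp: sup_pos_def)
  qed

  \<comment> \<open>The negative sign turns the lower deviations of the envelopes into upper deviations.\<close>
  define F where "F = insert (\<lambda>w. h (x0, w)) ((\<lambda>x w. - l x w) ` S)"
  have F: "finite F" "\<And>f. f \<in> F \<Longrightarrow> f \<in> borel_measurable \<mu>"
    "\<And>f. f \<in> F \<Longrightarrow> integrable \<mu> (\<lambda>w. \<bar>f w\<bar> powr q)"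
    using S(1) l_meas h_meas h_intq l_intq by (auto simp: F_def borel)

  have cover: "\<exists>f\<in>F. real n * (expectation f + \<epsilon> / 4) \<le> (\<Sum>i<n. f (y i))"
    if n: "n > 0" and dev: "ereal \<epsilon> \<le> \<bar>inf_val h (emp_measure n y) - inf_val h \<mu>\<bar>" for n y
  proof -
    define u where "u = (INF x. J n y x)"
    have "\<epsilon> \<le> \<bar>u - v\<bar>" using dev unfolding V\<mu> Vemp[OF n] u_def by simp
    then consider "v + \<epsilon> \<le> u" | "u \<le> v - \<epsilon>" by linarith
    then show ?thesis
    proof cases
      case 1
      have "u \<le> J n y x0" unfolding u_def by (intro cINF_lower bddJ n) simp
      then have "I x0 + \<epsilon> / 4 \<le> J n y x0" using 1 x0 \<open>\<epsilon> > 0\<close> by linarith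
      then have "real n * (I x0 + \<epsilon> / 4) \<le> (\<Sum>i<n. h (x0, y i))"
        using n by (simp add: J_def field_simps)
      then show ?thesis unfolding F_def I_def by blast
    next
      case 2
      then have "u < v - \<epsilon> / 2" using \<open>\<epsilon> > 0\<close> by linarith
      then obtain x where x: "J n y x < v - \<epsilon> / 2"
        unfolding u_def by (subst (asm) cINF_less_iff) (auto intro: bddJ n)
      obtain z where z: "z \<in> S" "x \<in> ball z (r z)" using S(2) by blast
      have "(\<Sum>i<n. l z (y i)) \<le> (\<Sum>i<n. h (x, y i))" by (intro sum_mono l_le z)
      moreover have "(\<Sum>i<n. h (x, y i)) \<le> real n * (v - \<epsilon> / 2)"
        using x n by (simp add: J_def field_simps)
      moreover have "real n * (v - \<epsilon> / 2) \<le> real n * (expectation (l z) - \<epsilon> / 4)"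
        using r(2)[of z] by (intro mult_left_mono) (auto simp: l_def[abs_def])
      ultimately have "real n * (- expectation (l z) + \<epsilon> / 4) \<le> (\<Sum>i<n. - l z (y i))"
        by (simp add: sum_negf algebra_simps)
      then have "real n * (expectation (\<lambda>w. - l z w) + \<epsilon> / 4) \<le> (\<Sum>i<n. - l z (y i))" by simp
      then show ?thesis using z(1) unfolding F_def by blast
    qed
  qed

  let ?P = "\<lambda>n. \<Pi>\<^sub>M i\<in>{..<n}. \<mu>"
  let ?D = "\<lambda>n f. {x \<in> space (?P n). real n * (expectation f + \<epsilon> / 4) \<le> (\<Sum>i<n. f (x i))}"
  have "\<exists>C. \<forall>f\<in>F. \<forall>\<^sub>F n in sequentially. measure (?P n) (?D n f) \<le> C f * real n powr (1 - q)"
    using F q \<open>\<epsilon> > 0\<close> by (intro bchoice ballI iid_mean_tail) auto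
  then obtain C where C: "\<forall>f\<in>F. \<forall>\<^sub>F n in sequentially.
      measure (?P n) (?D n f) \<le> C f * real n powr (1 - q)"
    by (elim exE)
  have "\<forall>\<^sub>F n in sequentially. \<forall>f\<in>F. measure (?P n) (?D n f) \<le> C f * real n powr (1 - q)"
    by (rule eventually_ball_finite[OF F(1) C])
  then have "\<forall>\<^sub>F n in sequentially. ereal (real n powr (q - 1) * measure (?P n)
      {x \<in> space (?P n). \<bar>inf_val h (emp_measure n x) - inf_val h \<mu>\<bar> \<ge> ereal \<epsilon>})
      \<le> ereal (\<Sum>f\<in>F. C f)"
    using eventually_gt_at_top[of 0]
  proof eventually_elim
    case (elim n)
    interpret P: finite_product_prob_space "\<lambda>_. \<mu>" "{..<n}"
      by unfold_locales auto
    let ?E = "{x \<in> space (?P n). \<bar>inf_val h (emp_measure n x) - inf_val h \<mu>\<bar> \<ge> ereal \<epsilon>}"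
    have D: "?D n f \<in> sets (?P n)" if "f \<in> F" for f
      using F(2)[OF that] by measurable
    \<comment> \<open>The event \<open>?E\<close> itself is not shown to be measurable: the measure of a non-measurable set is \<open>0\<close>,
       so monotonicity needs measurability of the larger set alone.\<close>
    have "measure (?P n) ?E \<le> measure (?P n) (\<Union>f\<in>F. ?D n f)"
    proof (rule P.finite_measure_mono)
      show "?E \<subseteq> (\<Union>f\<in>F. ?D n f)" using cover[OF elim(2)] by blast
      show "(\<Union>f\<in>F. ?D n f) \<in> sets (?P n)" using F(1) D by (intro sets.finite_UN)
    qed
    also have "\<dots> \<le> (\<Sum>f\<in>F. measure (?P n) (?D n f))"
      using F(1) D by (intro measure_UNION_le)
    also have "\<dots> \<le> (\<Sum>f\<in>F. C f * real n powr (1 - q))"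
      using elim(1) by (intro sum_mono) blast
    finally have "real n powr (q - 1) * measure (?P n) ?E
        \<le> real n powr (q - 1) * ((\<Sum>f\<in>F. C f) * real n powr (1 - q))"
      by (intro mult_left_mono) (auto simp: sum_distrib_right)
    also have "\<dots> = (\<Sum>f\<in>F. C f) * (real n powr (q - 1) * real n powr (1 - q))" by simp
    also have "real n powr (q - 1) * real n powr (1 - q) = 1"
      using elim(2) by (simp flip: powr_add)
    finally show ?case by simp
  qed
  then have "limsup (\<lambda>n. ereal (real n powr (q - 1) * measure (?P n)
      {x \<in> space (?P n). \<bar>inf_val h (emp_measure n x) - inf_val h \<mu>\<bar> \<ge> ereal \<epsilon>}))
      \<le> ereal (\<Sum>f\<in>F. C f)"
    by (rule Limsup_bounded)
  then show ?thesis by (rule le_less_trans) simp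
qed

end
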